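(* Let $K$ be a regular CW complex, let $U$ and $W$ be subcomplexes of $K$ with $K = U \cup W$, and let $\alpha$ be a uniformly $k$-local algorithm for some $k \ge 1$. Then $$V_{\alpha}(K) = \bigl(V_{\alpha}(U[k]) \cup V_{\alpha}(W[k])\bigr) \setminus \Bigl( V_{\alpha}\bigl(U[k]\cap W[k]\bigr) \setminus V_{\alpha}\bigl(U[2k+1] \cap W[2k+1]\bigr) \Bigr).$$
   Context: All complexes are regular CW complexes (characteristic maps of cells are homeomorphisms onto the closures of the cells). Neighborhoods. Two cells of a complex $K$ are adjacent if their closures have a point in common. The star of a cell $\sigma$ is the smallest subcomplex of $K$ containing all cells adjacent to $\sigma$. The star of a collection of cells is the smallest subcomplex containing the stars of all cells in the collection. For a subcomplex $K'$ of $K$, $K'[0]=K'$, $K'[1]$ is the star of $K'$ in $K$, and $K'[n+1]$ is the star of $K'[n]$; $K'[n]$ is the $n$-neighborhood of $K'$ in $K$. Likewise for a cell $\sigma$, $\sigma[1]$ is its star and $\sigma[n+1]$ is the star of $\sigma[n]$. For a subcomplex $C$ of $K$ and a cell $\sigma$ of $C$, $\sigma_C[k]$ denotes the $k$-neighborhood of $\sigma$ formed intrinsically within the complex $C$; thus $\sigma_K[k]=\sigma[k]$. The neighborhoods $U[k]$, $W[k]$, $U[2k+1]$, $W[2k+1]$ are formed in $K$. Algorithms and vector fields. A pair $(\sigma \le \tau)$ denotes a cell $\tau$ with a codimension $1$ face $\sigma$. An algorithm $\alpha$, using fixed data attached to the cells of $K$ (restricted to subcomplexes when applied to them), assigns to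 each subcomplex $C$ of $K$ (including $K$ itself) a discrete vector field $V_{\alpha}(C)$, i.e. a set of pairs $(\sigma\le\tau)$ of cells of $C$ that is the discrete gradient vector field of some discrete Morse function on $C$. The algorithm is uniformly $k$-local ($k>0$ fixed) if, for each pair $(\sigma\le\tau)$ of cells in $C$, the decision whether $(\sigma\le\tau)\in V_{\alpha}(C)$ is based only on data coming from $\sigma_C[k]$. In particular, if $C$, $C'$ are subcomplexes of $K$ both containing $\sigma$ and $\tau$ and $\sigma_C[k]=\sigma_{C'}[k]$, then $(\sigma\le\tau)\in V_{\alpha}(C)$ if and only if $(\sigma\le\tau)\in V_{\alpha}(C')$. *)

theory Defs
  imports "HOL-Analysis.Analysis"
begin

section \<open>Regular CW complexes\<close>

text \<open>The cells of a complex are its open cells, given as subsets of the underlying space. The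
  dimension function is only meaningful on cells.\<close>

record 'a cell_complex =
  cw_space :: "'a topology"
  cells :: "'a set set"
  cell_dim :: "'a set \<Rightarrow> nat"

definition nball :: "nat \<Rightarrow> (nat \<Rightarrow> real) topology" where
  "nball n = subtopology (Euclidean_space n) {x. (\<Sum>i<n. (x i)\<^sup>2) \<le> 1}"

definition nball_interior :: "nat \<Rightarrow> (nat \<Rightarrow> real) set" where
  "nball_interior n = {x \<in> topspace (nball n). (\<Sum>i<n. (x i)\<^sup>2) < 1}"

definition nball_boundary :: "nat \<Rightarrow> (nat \<Rightarrow> real) set" where
  "nball_boundary n = {x \<in> topspace (nball n). (\<Sum>i<n. (x i)\<^sup>2) = 1}"

abbreviation cell_closure :: "'a cell_complex \<Rightarrow> 'a set \<Rightarrow> 'a set" where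
  "cell_closure K \<sigma> \<equiv> cw_space K closure_of \<sigma>"

definition regular_characteristic_map ::
    "'a cell_complex \<Rightarrow> 'a set \<Rightarrow> ((nat \<Rightarrow> real) \<Rightarrow> 'a) \<Rightarrow> bool" where
  "regular_characteristic_map K \<sigma> \<phi> \<longleftrightarrow>
     homeomorphic_map (nball (cell_dim K \<sigma>))
       (subtopology (cw_space K) (cell_closure K \<sigma>)) \<phi> \<and>
     \<phi> ` nball_interior (cell_dim K \<sigma>) = \<sigma> \<and>
     (\<exists>F. finite F \<and> F \<subseteq> cells K \<and> (\<forall>\<tau>\<in>F. cell_dim K \<tau> < cell_dim K \<sigma>) \<and>
          \<phi> ` nball_boundary (cell_dim K \<sigma>) \<subseteq> \<Union>F)"

text \<open>The last condition says that the space carries the weak topology; its converse holds in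
  every topological space.\<close>

definition regular_CW_complex :: "'a cell_complex \<Rightarrow> bool" where
  "regular_CW_complex K \<longleftrightarrow>
     Hausdorff_space (cw_space K) \<and>
     \<Union>(cells K) = topspace (cw_space K) \<and>
     disjoint (cells K) \<and>
     (\<forall>\<sigma>\<in>cells K. \<exists>\<phi>. regular_characteristic_map K \<sigma> \<phi>) \<and>
     (\<forall>A \<subseteq> topspace (cw_space K).
        (\<forall>\<sigma>\<in>cells K. closedin (cw_space K) (A \<inter> cell_closure K \<sigma>)) \<longrightarrow> closedin (cw_space K) A)"

text \<open>A subcomplex is represented by its set of cells, so unions and intersections of subcomplexes
  are those of sets of cells; \<open>restrict_complex\<close> turns it into a complex in its own right.\<close>

definition subcomplex :: "'a cell_complex \<Rightarrow> 'a set set \<Rightarrow> bool" where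
  "subcomplex K C \<longleftrightarrow> C \<subseteq> cells K \<and> (\<forall>\<sigma>\<in>C. cell_closure K \<sigma> \<subseteq> \<Union>C)"

definition restrict_complex :: "'a cell_complex \<Rightarrow> 'a set set \<Rightarrow> 'a cell_complex" where
  "restrict_complex K C =
     \<lparr>cw_space = subtopology (cw_space K) (\<Union>C), cells = C, cell_dim = cell_dim K\<rparr>"

section \<open>Neighborhoods\<close>

definition adjacent :: "'a cell_complex \<Rightarrow> 'a set \<Rightarrow> 'a set \<Rightarrow> bool" where
  "adjacent K \<sigma> \<tau> \<longleftrightarrow> cell_closure K \<sigma> \<inter> cell_closure K \<tau> \<noteq> {}"

definition cell_star :: "'a cell_complex \<Rightarrow> 'a set \<Rightarrow> 'a set set" where
  "cell_star K \<sigma> = subcomplex K hull {\<tau> \<in> cells K. adjacent K \<sigma> \<tau>}"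

definition star :: "'a cell_complex \<Rightarrow> 'a set set \<Rightarrow> 'a set set" where
  "star K S = subcomplex K hull (\<Union>\<sigma>\<in>S. cell_star K \<sigma>)"

primrec nbhd :: "'a cell_complex \<Rightarrow> 'a set set \<Rightarrow> nat \<Rightarrow> 'a set set" where
  "nbhd K S 0 = S"
| "nbhd K S (Suc n) = star K (nbhd K S n)"

text \<open>The \<open>k\<close>-neighborhood of \<open>\<sigma>\<close> formed intrinsically within \<open>C\<close>, for \<open>k \<ge> 1\<close>. (For \<open>k = 0\<close>, where
  no neighborhood of a cell is defined, this is the singleton of \<open>\<sigma>\<close>, in general not a
  subcomplex.)\<close>

definition cell_nbhd :: "'a cell_complex \<Rightarrow> 'a set set \<Rightarrow> 'a set \<Rightarrow> nat \<Rightarrow> 'a set set" where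
  "cell_nbhd K C \<sigma> k = nbhd (restrict_complex K C) {\<sigma>} k"

section \<open>Discrete Morse functions and gradient vector fields\<close>

definition codim1_pair :: "'a cell_complex \<Rightarrow> 'a set \<Rightarrow> 'a set \<Rightarrow> bool" where
  "codim1_pair K \<sigma> \<tau> \<longleftrightarrow> \<sigma> \<in> cells K \<and> \<tau> \<in> cells K \<and>
     \<sigma> \<subseteq> cell_closure K \<tau> \<and> cell_dim K \<tau> = cell_dim K \<sigma> + 1"

text \<open>Forman's definitions. The finiteness conjuncts matter because infinite sets have cardinality
  \<open>0\<close>.\<close>

definition discrete_Morse_function :: "'a cell_complex \<Rightarrow> ('a set \<Rightarrow> real) \<Rightarrow> bool" where
  "discrete_Morse_function K f \<longleftrightarrow>
     (\<forall>\<sigma>\<in>cells K.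
        finite {\<tau>. codim1_pair K \<sigma> \<tau> \<and> f \<tau> \<le> f \<sigma>} \<and>
        card {\<tau>. codim1_pair K \<sigma> \<tau> \<and> f \<tau> \<le> f \<sigma>} \<le> 1 \<and>
        finite {\<nu>. codim1_pair K \<nu> \<sigma> \<and> f \<nu> \<ge> f \<sigma>} \<and>
        card {\<nu>. codim1_pair K \<nu> \<sigma> \<and> f \<nu> \<ge> f \<sigma>} \<le> 1)"

definition gradient_field :: "'a cell_complex \<Rightarrow> ('a set \<Rightarrow> real) \<Rightarrow> ('a set \<times> 'a set) set" where
  "gradient_field K f = {(\<sigma>, \<tau>). codim1_pair K \<sigma> \<tau> \<and> f \<tau> \<le> f \<sigma>}"

definition discrete_vector_field :: "'a cell_complex \<Rightarrow> ('a set \<times> 'a set) set \<Rightarrow> bool" where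
  "discrete_vector_field K V \<longleftrightarrow> (\<exists>f. discrete_Morse_function K f \<and> V = gradient_field K f)"

section \<open>Algorithms\<close>

text \<open>An algorithm takes a complex together with data of type \<open>'d\<close> on its cells and returns a set
  of pairs of cells. It is run on a subcomplex \<open>C\<close> of \<open>K\<close> with the restriction to \<open>C\<close> of the data
  \<open>D\<close> fixed on \<open>K\<close>.\<close>

type_synonym ('a, 'd) algorithm =
  "'a cell_complex \<Rightarrow> ('a set \<Rightarrow> 'd) \<Rightarrow> ('a set \<times> 'a set) set"

definition alg_field ::
    "('a, 'd) algorithm \<Rightarrow> 'a cell_complex \<Rightarrow> ('a set \<Rightarrow> 'd) \<Rightarrow> 'a set set \<Rightarrow> ('a set \<times> 'a set) set"
  where "alg_field \<alpha> K D C = \<alpha> (restrict_complex K C) (restrict D C)"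

definition vector_field_algorithm ::
    "('a, 'd) algorithm \<Rightarrow> 'a cell_complex \<Rightarrow> ('a set \<Rightarrow> 'd) \<Rightarrow> bool" where
  "vector_field_algorithm \<alpha> K D \<longleftrightarrow>
     (\<forall>C. subcomplex K C \<longrightarrow> discrete_vector_field (restrict_complex K C) (alg_field \<alpha> K D C))"

text \<open>The decision rule \<open>\<delta>\<close> may depend on the pair and on everything seen in the intrinsic
  neighborhood \<open>\<sigma>\<^sub>C[k]\<close>, but not otherwise on \<open>C\<close>.\<close>

definition uniformly_local ::
    "('a, 'd) algorithm \<Rightarrow> 'a cell_complex \<Rightarrow> ('a set \<Rightarrow> 'd) \<Rightarrow> nat \<Rightarrow> bool" where
  "uniformly_local \<alpha> K D k \<longleftrightarrow>
     (\<exists>\<delta> :: 'a set \<Rightarrow> 'a set \<Rightarrow> 'a cell_complex \<Rightarrow> ('a set \<Rightarrow> 'd) \<Rightarrow> bool.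
        \<forall>C \<sigma> \<tau>. subcomplex K C \<longrightarrow> codim1_pair (restrict_complex K C) \<sigma> \<tau> \<longrightarrow>
          ((\<sigma>, \<tau>) \<in> alg_field \<alpha> K D C \<longleftrightarrow>
           \<delta> \<sigma> \<tau> (restrict_complex K (cell_nbhd K C \<sigma> k)) (restrict D (cell_nbhd K C \<sigma> k))))"

end

theory Submission
  imports Defs
begin

text \<open>Fix a pair \<open>(\<sigma>, \<tau>)\<close>. Locality says that two subcomplexes \<open>C \<subseteq> E\<close> give the same decision on it
  as soon as \<open>C\<close> contains the whole intrinsic neighborhood \<open>\<sigma>\<^sub>E[k]\<close>, because then \<open>\<sigma>\<^sub>C[k] = \<sigma>\<^sub>E[k]\<close>
  (lemma \<open>alg_field_iff_if_cell_nbhd_subset\<close>). By symmetry suppose \<open>\<sigma> \<in> U\<close>. Three comparisons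
  of this kind then decide everything.

  \<^item> \<open>\<sigma>\<^sub>K[k] \<subseteq> U[k]\<close>, so \<open>K\<close> and \<open>U[k]\<close> agree on the pair.
  \<^item> If moreover \<open>\<sigma> \<in> W[k]\<close>, then \<open>\<sigma>\<^sub>K[k] \<subseteq> U[k] \<inter> W[2k] \<subseteq> U[2k+1] \<inter> W[2k+1]\<close>, so \<open>K\<close> and
    \<open>U[2k+1] \<inter> W[2k+1]\<close> agree.
  \<^item> In that same case the neighborhood of \<open>\<sigma>\<close> intrinsic to \<open>W[k]\<close> lies in \<open>\<sigma>\<^sub>K[k] \<subseteq> U[k]\<close>, so
    \<open>W[k]\<close> and \<open>U[k] \<inter> W[k]\<close> agree.

  The only possible error of \<open>V(U[k]) \<union> V(W[k])\<close> is thus a pair wrongly selected by \<open>W[k]\<close>, near the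
  outer edge of \<open>W[k]\<close>; it is also selected by \<open>U[k] \<inter> W[k]\<close>, but not by the larger
  intersection, which agrees with \<open>K\<close>. Hence removing the difference of the two intersections
  deletes exactly these errors and nothing else.

  The third comparison treats \<open>W[k]\<close> as an ambient complex. The lemmas are therefore stated for
  complexes whose open cells partition the space into nonempty sets, a property that passes
  directly to subcomplexes.\<close>

section \<open>Cell partitions and subcomplexes\<close>

abbreviation cell_partition :: "'a cell_complex \<Rightarrow> bool" where
  "cell_partition K \<equiv> partition_on (topspace (cw_space K)) (cells K)"

text \<open>A cell is nonempty because it contains the image of the center of its ball.\<close>

lemma regular_CW_complex_cell_partition:
  assumes "regular_CW_complex K"
  shows "cell_partition K"
  unfolding partition_on_def
proof (intro conjI)
  show "\<Union>(cells K) = topspace (cw_space K)" "disjoint (cells K)"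
    using assms by (simp_all add: regular_CW_complex_def)
  have "\<sigma> \<noteq> {}" if \<sigma>: "\<sigma> \<in> cells K" for \<sigma>
  proof -
    obtain \<phi> where "regular_characteristic_map K \<sigma> \<phi>"
      using assms \<sigma> unfolding regular_CW_complex_def by blast
    then have "\<phi> ` nball_interior (cell_dim K \<sigma>) = \<sigma>"
      by (simp add: regular_characteristic_map_def)
    moreover have "(\<lambda>_. 0) \<in> nball_interior (cell_dim K \<sigma>)"
      by (simp add: nball_interior_def nball_def topspace_Euclidean_space)
    ultimately show ?thesis by blast
  qed
  then show "{} \<notin> cells K" by blast
qed

lemma cell_subset_closure:
  assumes "cell_partition K" and "\<sigma> \<in> cells K"
  shows "\<sigma> \<subseteq> cell_closure K \<sigma>"
  using assms by (intro closure_of_subset) (auto simp: partition_on_def)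

lemma subcomplex_cells:
  assumes "cell_partition K"
  shows "subcomplex K (cells K)"
  using assms by (auto simp: subcomplex_def partition_on_def closure_of_subset_topspace[THEN subsetD])

text \<open>Since cells are disjoint, a point lying in the unions of several subcomplexes lies in
  one and the same cell of all of them.\<close>

lemma subcomplex_Inter:
  assumes "cell_partition K" and "\<And>C. C \<in> \<C> \<Longrightarrow> subcomplex K C" and "\<C> \<noteq> {}"
  shows "subcomplex K (\<Inter>\<C>)"
  unfolding subcomplex_def
proof (intro conjI ballI subsetI)
  show "\<sigma> \<in> cells K" if "\<sigma> \<in> \<Inter>\<C>" for \<sigma>
    using that assms(2,3) unfolding subcomplex_def by blast
next
  fix \<sigma> x assume \<sigma>: "\<sigma> \<in> \<Inter>\<C>" and x: "x \<in> cell_closure K \<sigma>"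
  obtain C where "C \<in> \<C>" using assms(3) by blast
  then obtain c where c: "c \<in> C" "x \<in> c"
    using \<sigma> x assms(2) unfolding subcomplex_def by blast
  have "c \<in> C'" if C': "C' \<in> \<C>" for C'
  proof -
    obtain c' where c': "c' \<in> C'" "x \<in> c'"
      using \<sigma> x assms(2) C' unfolding subcomplex_def by blast
    have "c \<in> cells K" "c' \<in> cells K"
      using c c' \<open>C \<in> \<C>\<close> C' assms(2) unfolding subcomplex_def by blast+
    then have "c = c'"
      using assms(1) c c' by (auto simp: partition_on_def disjoint_def)
    then show ?thesis using c' by simp
  qed
  then show "x \<in> \<Union>(\<Inter>\<C>)" using c by blast
qed

lemma subcomplex_Int:
  assumes "cell_partition K" and "subcomplex K C" and "subcomplex K E"
  shows "subcomplex K (C \<inter> E)"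
  using subcomplex_Inter[OF assms(1), of "{C, E}"] assms(2,3) by auto

lemma subcomplex_hull:
  assumes "cell_partition K" and "S \<subseteq> cells K"
  shows "subcomplex K (subcomplex K hull S)"
  unfolding hull_def
  by (rule subcomplex_Inter[OF assms(1)]) (use assms subcomplex_cells in auto)

section \<open>Restriction to a subcomplex\<close>

lemma cells_restrict_complex [simp]: "cells (restrict_complex K C) = C"
  by (simp add: restrict_complex_def)

lemma restrict_complex_restrict_complex:
  assumes "C \<subseteq> E"
  shows "restrict_complex (restrict_complex K E) C = restrict_complex K C"
proof -
  have "\<Union>E \<inter> \<Union>C = \<Union>C" using assms by blast
  then show ?thesis by (simp add: restrict_complex_def subtopology_subtopology)
qed

lemma restrict_complex_cells:
  assumes "cell_partition K"
  shows "restrict_complex K (cells K) = K"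
proof -
  have "cw_space (restrict_complex K (cells K)) = cw_space K"
    using assms by (simp add: restrict_complex_def partition_on_def subtopology_topspace)
  then show ?thesis by (simp add: restrict_complex_def)
qed

lemma cell_partition_restrict_complex:
  assumes "cell_partition K" and "subcomplex K C"
  shows "cell_partition (restrict_complex K C)"
proof -
  have "C \<subseteq> cells K" using assms(2) by (simp add: subcomplex_def)
  moreover have "\<Union>C \<subseteq> topspace (cw_space K)"
    using assms(1) calculation by (auto simp: partition_on_def)
  ultimately show ?thesis
    using assms(1) unfolding partition_on_def
    by (auto simp: restrict_complex_def Int_absorb1 intro: pairwise_subset)
qed

text \<open>A subcomplex contains the closures of its cells, so passing to it changes no closure.\<close>

lemma cell_closure_restrict_complex:
  assumes "subcomplex K C" and "\<sigma> \<in> C"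
  shows "cell_closure (restrict_complex K C) \<sigma> = cell_closure K \<sigma>"
proof -
  have "\<Union>C \<inter> \<sigma> = \<sigma>" "cell_closure K \<sigma> \<subseteq> \<Union>C"
    using assms by (auto simp: subcomplex_def)
  then show ?thesis by (auto simp: restrict_complex_def closure_of_subtopology)
qed

lemma subcomplex_restrict_complex_iff:
  assumes "subcomplex K C"
  shows "subcomplex (restrict_complex K C) T \<longleftrightarrow> T \<subseteq> C \<and> subcomplex K T"
proof -
  have "cell_closure (restrict_complex K C) \<sigma> = cell_closure K \<sigma>" if "T \<subseteq> C" "\<sigma> \<in> T" for \<sigma>
    using cell_closure_restrict_complex[OF assms] that by blast
  moreover have "C \<subseteq> cells K" using assms by (simp add: subcomplex_def)
  ultimately show ?thesis unfolding subcomplex_def cells_restrict_complex by blast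
qed

lemma codim1_pair_restrict_complex_iff:
  assumes "subcomplex K C"
  shows "codim1_pair (restrict_complex K C) \<sigma> \<tau> \<longleftrightarrow> codim1_pair K \<sigma> \<tau> \<and> \<sigma> \<in> C \<and> \<tau> \<in> C"
proof (cases "\<tau> \<in> C")
  case True
  then show ?thesis
    using cell_closure_restrict_complex[OF assms True] assms
    by (auto simp: codim1_pair_def subcomplex_def restrict_complex_def)
qed (simp add: codim1_pair_def)

section \<open>Stars and neighborhoods\<close>

definition adjacent_cells :: "'a cell_complex \<Rightarrow> 'a set set \<Rightarrow> 'a set set" where
  "adjacent_cells K S = {\<tau> \<in> cells K. \<exists>\<sigma>\<in>S. adjacent K \<sigma> \<tau>}"

text \<open>A subcomplex contains the star of each \<open>\<sigma> \<in> S\<close> as soon as it contains the cells adjacent to \<open>\<sigma>\<close>,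
  so the nested hulls collapse to one.\<close>

lemma star_eq_hull_adjacent_cells: "star K S = subcomplex K hull (adjacent_cells K S)"
proof
  show "star K S \<subseteq> subcomplex K hull (adjacent_cells K S)"
    unfolding star_def cell_star_def adjacent_cells_def hull_def by blast
  have "adjacent_cells K S \<subseteq> (\<Union>\<sigma>\<in>S. cell_star K \<sigma>)"
    unfolding adjacent_cells_def cell_star_def hull_def by blast
  then show "subcomplex K hull (adjacent_cells K S) \<subseteq> star K S"
    unfolding star_def by (rule hull_mono)
qed

lemma star_mono: "S \<subseteq> T \<Longrightarrow> star K S \<subseteq> star K T"
  unfolding star_eq_hull_adjacent_cells by (intro hull_mono) (auto simp: adjacent_cells_def)

lemma adjacent_cells_subset_star: "adjacent_cells K S \<subseteq> star K S"
  unfolding star_eq_hull_adjacent_cells by (rule hull_subset)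

lemma subcomplex_star:
  assumes "cell_partition K"
  shows "subcomplex K (star K S)"
  unfolding star_eq_hull_adjacent_cells
  by (rule subcomplex_hull[OF assms]) (auto simp: adjacent_cells_def)

lemma subset_star:
  assumes "cell_partition K" and "S \<subseteq> cells K"
  shows "S \<subseteq> star K S"
proof -
  have "adjacent K \<sigma> \<sigma>" if "\<sigma> \<in> S" for \<sigma>
    using cell_subset_closure[OF assms(1), of \<sigma>] assms that
    by (auto simp: adjacent_def partition_on_def)
  then have "S \<subseteq> adjacent_cells K S" using assms(2) by (auto simp: adjacent_cells_def)
  then show ?thesis using adjacent_cells_subset_star by blast
qed

lemma nbhd_subset_cells:
  assumes "cell_partition K" and "S \<subseteq> cells K"
  shows "nbhd K S n \<subseteq> cells K"
  using subcomplex_star[OF assms(1)] assms(2) by (cases n) (auto simp: subcomplex_def)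

lemma subcomplex_nbhd:
  assumes "cell_partition K" and "subcomplex K S"
  shows "subcomplex K (nbhd K S n)"
  using subcomplex_star[OF assms(1)] assms(2) by (cases n) auto

lemma nbhd_mono: "S \<subseteq> T \<Longrightarrow> nbhd K S n \<subseteq> nbhd K T n"
  by (induction n) (auto intro: star_mono[THEN subsetD])

lemma nbhd_le_mono:
  assumes "cell_partition K" and "S \<subseteq> cells K" and "m \<le> n"
  shows "nbhd K S m \<subseteq> nbhd K S n"
  using assms(3) by (rule lift_Suc_mono_le[rotated])
    (simp add: subset_star[OF assms(1) nbhd_subset_cells[OF assms(1,2)]])

lemma nbhd_add: "nbhd K S (m + n) = nbhd K (nbhd K S m) n"
  by (induction n) auto

text \<open>A codimension-one coface of \<open>\<sigma>\<close> is adjacent to \<open>\<sigma>\<close>, so it is visible from \<open>\<sigma>\<close> as soon as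
  \<open>k \<ge> 1\<close>.\<close>

lemma coface_in_nbhd:
  assumes "cell_partition K" and "codim1_pair K \<sigma> \<tau>" and "k \<ge> 1"
  shows "\<tau> \<in> nbhd K {\<sigma>} k"
proof -
  have cells: "\<sigma> \<in> cells K" "\<tau> \<in> cells K" "\<sigma> \<subseteq> cell_closure K \<tau>"
    using assms(2) by (auto simp: codim1_pair_def)
  moreover have "\<sigma> \<noteq> {}" using cells(1) assms(1) by (auto simp: partition_on_def)
  ultimately have "adjacent K \<sigma> \<tau>"
    using cell_subset_closure[OF assms(1), of \<sigma>] unfolding adjacent_def by blast
  then have "\<tau> \<in> nbhd K {\<sigma>} 1"
    using cells adjacent_cells_subset_star[of K "{\<sigma>}"] by (auto simp: adjacent_cells_def)
  then show ?thesis using nbhd_le_mono[OF assms(1) _ assms(3), of "{\<sigma>}"] cells by auto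
qed

section \<open>Neighborhoods intrinsic to a subcomplex\<close>

lemma adjacent_cells_restrict_complex:
  assumes "subcomplex K C" and "S \<subseteq> C"
  shows "adjacent_cells (restrict_complex K C) S = adjacent_cells K S \<inter> C"
proof -
  have "adjacent (restrict_complex K C) \<sigma> \<tau> \<longleftrightarrow> adjacent K \<sigma> \<tau>" if "\<sigma> \<in> S" "\<tau> \<in> C" for \<sigma> \<tau>
    using that assms(2) cell_closure_restrict_complex[OF assms(1)]
    by (simp add: adjacent_def subset_iff)
  moreover have "C \<subseteq> cells K" using assms(1) by (simp add: subcomplex_def)
  ultimately show ?thesis by (auto simp: adjacent_cells_def)
qed

text \<open>The trace on \<open>C\<close> of the star in \<open>K\<close> is a subcomplex of \<open>C\<close> containing all cells adjacent
  within \<open>C\<close>, hence contains the intrinsic star.\<close>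

lemma star_restrict_complex_subset:
  assumes "cell_partition K" and "subcomplex K C" and "S \<subseteq> C"
  shows "star (restrict_complex K C) S \<subseteq> star K S"
proof -
  have "subcomplex (restrict_complex K C) (star K S \<inter> C)"
    using subcomplex_Int[OF assms(1) subcomplex_star[OF assms(1)] assms(2)]
    by (simp add: subcomplex_restrict_complex_iff[OF assms(2)])
  moreover have "adjacent_cells (restrict_complex K C) S \<subseteq> star K S \<inter> C"
    using adjacent_cells_subset_star[of K S]
    by (auto simp: adjacent_cells_restrict_complex[OF assms(2,3)])
  ultimately have "star (restrict_complex K C) S \<subseteq> star K S \<inter> C"
    unfolding star_eq_hull_adjacent_cells[of "restrict_complex K C"] by (intro hull_minimal)
  then show ?thesis by blast
qed

text \<open>Conversely, a subcomplex of \<open>C\<close> is a subcomplex of \<open>K\<close>; so if \<open>C\<close> contains all cells adjacent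
  to \<open>S\<close> in \<open>K\<close>, its intrinsic star competes in the minimality that defines the star in \<open>K\<close>.\<close>

lemma star_restrict_complex_eq:
  assumes "cell_partition K" and "subcomplex K C" and "S \<subseteq> C" and "star K S \<subseteq> C"
  shows "star (restrict_complex K C) S = star K S"
proof
  show "star (restrict_complex K C) S \<subseteq> star K S"
    using assms(1-3) by (rule star_restrict_complex_subset)
  have "adjacent_cells K S \<subseteq> adjacent_cells (restrict_complex K C) S"
    using adjacent_cells_subset_star[of K S] assms(4)
    by (auto simp: adjacent_cells_restrict_complex[OF assms(2,3)])
  then have "adjacent_cells K S \<subseteq> star (restrict_complex K C) S"
    using adjacent_cells_subset_star by blast
  moreover have "subcomplex K (star (restrict_complex K C) S)"
    using subcomplex_star[OF cell_partition_restrict_complex[OF assms(1,2)], of S]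
    by (simp add: subcomplex_restrict_complex_iff[OF assms(2)])
  ultimately show "star K S \<subseteq> star (restrict_complex K C) S"
    unfolding star_eq_hull_adjacent_cells[of K] by (intro hull_minimal)
qed

lemma nbhd_restrict_complex_subset:
  assumes "cell_partition K" and "subcomplex K C" and "S \<subseteq> C"
  shows "nbhd (restrict_complex K C) S n \<subseteq> nbhd K S n"
proof (induction n)
  case (Suc n)
  have "nbhd (restrict_complex K C) S n \<subseteq> C"
    using nbhd_subset_cells[OF cell_partition_restrict_complex[OF assms(1,2)]] assms(3) by simp
  then have "nbhd (restrict_complex K C) S (Suc n) \<subseteq> star K (nbhd (restrict_complex K C) S n)"
    by (simp add: star_restrict_complex_subset[OF assms(1,2)])
  also have "\<dots> \<subseteq> nbhd K S (Suc n)" using star_mono[OF Suc] by simp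
  finally show ?case .
qed simp

lemma nbhd_restrict_complex_eq:
  assumes "cell_partition K" and "subcomplex K C" and "S \<subseteq> C" and "nbhd K S n \<subseteq> C"
  shows "nbhd (restrict_complex K C) S n = nbhd K S n"
  using assms(4)
proof (induction n)
  case (Suc n)
  have "S \<subseteq> cells K" using assms(2,3) by (auto simp: subcomplex_def)
  then have "nbhd K S n \<subseteq> nbhd K S (Suc n)" by (rule nbhd_le_mono[OF assms(1)]) simp
  then have "nbhd K S n \<subseteq> C" using Suc.prems by blast
  then show ?case
    using Suc star_restrict_complex_eq[OF assms(1,2)] by simp
qed simp

section \<open>Comparing the vector fields of a local algorithm\<close>

lemma alg_field_codim1_pair:
  assumes "vector_field_algorithm \<alpha> K D" and "subcomplex K C" and "(\<sigma>, \<tau>) \<in> alg_field \<alpha> K D C"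
  shows "codim1_pair (restrict_complex K C) \<sigma> \<tau>"
  using assms unfolding vector_field_algorithm_def discrete_vector_field_def gradient_field_def
  by blast

lemma alg_field_cells:
  assumes "vector_field_algorithm \<alpha> K D" and "subcomplex K C" and "(\<sigma>, \<tau>) \<in> alg_field \<alpha> K D C"
  shows "\<sigma> \<in> C" "\<tau> \<in> C"
  using alg_field_codim1_pair[OF assms] by (simp_all add: codim1_pair_def)

text \<open>The hypothesis gives \<open>\<sigma>\<^sub>C[k] = \<sigma>\<^sub>E[k]\<close> by the results above with \<open>E\<close> as the ambient complex.
  If \<open>(\<sigma>, \<tau>)\<close> is a codimension-one pair of \<open>E\<close>, it is one of \<open>C\<close> too, since \<open>\<tau>\<close> is adjacent to \<open>\<sigma>\<close>
  and so lies in \<open>\<sigma>\<^sub>E[k] \<subseteq> C\<close>; otherwise neither field contains it.\<close>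

lemma alg_field_iff_if_cell_nbhd_subset:
  assumes "cell_partition K" and "vector_field_algorithm \<alpha> K D"
    and "k \<ge> 1" and "uniformly_local \<alpha> K D k"
    and C: "subcomplex K C" and E: "subcomplex K E" and "C \<subseteq> E"
    and "\<sigma> \<in> C" and sub: "cell_nbhd K E \<sigma> k \<subseteq> C"
  shows "(\<sigma>, \<tau>) \<in> alg_field \<alpha> K D C \<longleftrightarrow> (\<sigma>, \<tau>) \<in> alg_field \<alpha> K D E"
proof (cases "codim1_pair (restrict_complex K E) \<sigma> \<tau>")
  case True
  note partE = cell_partition_restrict_complex[OF \<open>cell_partition K\<close> E]
  have "subcomplex (restrict_complex K E) C"
    using C \<open>C \<subseteq> E\<close> by (simp add: subcomplex_restrict_complex_iff[OF E])
  from nbhd_restrict_complex_eq[OF partE this, of "{\<sigma>}" k]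
  have same_nbhd: "cell_nbhd K C \<sigma> k = cell_nbhd K E \<sigma> k"
    using sub \<open>\<sigma> \<in> C\<close> by (simp add: cell_nbhd_def restrict_complex_restrict_complex[OF \<open>C \<subseteq> E\<close>])
  have "\<tau> \<in> C"
    using coface_in_nbhd[OF partE True \<open>k \<ge> 1\<close>] sub by (auto simp: cell_nbhd_def)
  then have pairC: "codim1_pair (restrict_complex K C) \<sigma> \<tau>"
    using True \<open>\<sigma> \<in> C\<close>
    by (simp add: codim1_pair_restrict_complex_iff[OF C] codim1_pair_restrict_complex_iff[OF E])
  obtain \<delta> where \<delta>: "\<And>C \<sigma> \<tau>. subcomplex K C \<Longrightarrow> codim1_pair (restrict_complex K C) \<sigma> \<tau> \<Longrightarrow>
      (\<sigma>, \<tau>) \<in> alg_field \<alpha> K D C \<longleftrightarrow>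
      \<delta> \<sigma> \<tau> (restrict_complex K (cell_nbhd K C \<sigma> k)) (restrict D (cell_nbhd K C \<sigma> k))"
    using \<open>uniformly_local \<alpha> K D k\<close> unfolding uniformly_local_def by blast
  show ?thesis using \<delta>[OF C pairC] \<delta>[OF E True] by (simp add: same_nbhd)
next
  case False
  then have "\<not> codim1_pair (restrict_complex K C) \<sigma> \<tau>"
    using \<open>C \<subseteq> E\<close>
    by (auto simp: codim1_pair_restrict_complex_iff[OF C] codim1_pair_restrict_complex_iff[OF E])
  then show ?thesis using False alg_field_codim1_pair[OF assms(2)] C E by blast
qed

text \<open>The facts \<open>K_U\<close>, \<open>K_J\<close> and \<open>W_I\<close> are the three comparisons of the introduction; the formula is a
  Boolean consequence of them.\<close>

lemma alg_field_decomposition_at_cell: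
  assumes part: "cell_partition K" and U: "subcomplex K U" and W: "subcomplex K W"
    and alg: "vector_field_algorithm \<alpha> K D"
    and "k \<ge> 1" and "uniformly_local \<alpha> K D k"
    and "\<sigma> \<in> U"
  shows "(\<sigma>, \<tau>) \<in> alg_field \<alpha> K D (cells K) \<longleftrightarrow>
    (\<sigma>, \<tau>) \<in> (alg_field \<alpha> K D (nbhd K U k) \<union> alg_field \<alpha> K D (nbhd K W k)) -
      (alg_field \<alpha> K D (nbhd K U k \<inter> nbhd K W k) -
       alg_field \<alpha> K D (nbhd K U (2 * k + 1) \<inter> nbhd K W (2 * k + 1)))"
proof -
  let ?V = "alg_field \<alpha> K D"
  let ?I = "nbhd K U k \<inter> nbhd K W k"
  let ?J = "nbhd K U (2 * k + 1) \<inter> nbhd K W (2 * k + 1)"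
  note compare = alg_field_iff_if_cell_nbhd_subset[OF part alg \<open>k \<ge> 1\<close> \<open>uniformly_local \<alpha> K D k\<close>]
  note sub_K = subcomplex_cells[OF part]
  note sub_U = subcomplex_nbhd[OF part U] and sub_W = subcomplex_nbhd[OF part W]
  note sub_I = subcomplex_Int[OF part sub_U[of k] sub_W[of k]]
  note sub_J = subcomplex_Int[OF part sub_U[of "2 * k + 1"] sub_W[of "2 * k + 1"]]
  have in_cells: "C \<subseteq> cells K" if "subcomplex K C" for C
    using that by (simp add: subcomplex_def)
  have nbhd_K: "cell_nbhd K (cells K) \<sigma> k = nbhd K {\<sigma>} k"
    by (simp add: cell_nbhd_def restrict_complex_cells[OF part])
  have near_U: "nbhd K {\<sigma>} k \<subseteq> nbhd K U k"
    using \<open>\<sigma> \<in> U\<close> by (intro nbhd_mono) simp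
  have "\<sigma> \<in> nbhd K U k"
    using nbhd_le_mono[OF part in_cells[OF U], of 0 k] \<open>\<sigma> \<in> U\<close> by auto
  then have K_U: "(\<sigma>, \<tau>) \<in> ?V (nbhd K U k) \<longleftrightarrow> (\<sigma>, \<tau>) \<in> ?V (cells K)"
    using near_U by (intro compare sub_U sub_K in_cells) (auto simp: nbhd_K)
  have K_J: "(\<sigma>, \<tau>) \<in> ?V ?J \<longleftrightarrow> (\<sigma>, \<tau>) \<in> ?V (cells K)" if "\<sigma> \<in> nbhd K W k"
  proof -
    have "nbhd K {\<sigma>} k \<subseteq> nbhd K W (k + k)"
      unfolding nbhd_add using that by (intro nbhd_mono) simp
    also have "\<dots> \<subseteq> nbhd K W (2 * k + 1)"
      by (rule nbhd_le_mono[OF part in_cells[OF W]]) simp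
    finally have near_W: "nbhd K {\<sigma>} k \<subseteq> nbhd K W (2 * k + 1)" .
    moreover have "nbhd K U k \<subseteq> nbhd K U (2 * k + 1)"
      by (rule nbhd_le_mono[OF part in_cells[OF U]]) simp
    moreover have "nbhd K W k \<subseteq> nbhd K W (2 * k + 1)"
      by (rule nbhd_le_mono[OF part in_cells[OF W]]) simp
    ultimately show ?thesis
      using near_U \<open>\<sigma> \<in> nbhd K U k\<close> that by (intro compare sub_J sub_K in_cells) (auto simp: nbhd_K)
  qed
  have W_I: "(\<sigma>, \<tau>) \<in> ?V ?I \<longleftrightarrow> (\<sigma>, \<tau>) \<in> ?V (nbhd K W k)" if "\<sigma> \<in> nbhd K W k"
  proof -
    have "cell_nbhd K (nbhd K W k) \<sigma> k \<subseteq> nbhd K {\<sigma>} k"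
      unfolding cell_nbhd_def by (rule nbhd_restrict_complex_subset[OF part sub_W]) (simp add: that)
    moreover have "cell_nbhd K (nbhd K W k) \<sigma> k \<subseteq> nbhd K W k"
      using nbhd_subset_cells[OF cell_partition_restrict_complex[OF part sub_W]] that
      unfolding cell_nbhd_def by simp
    ultimately show ?thesis
      using near_U \<open>\<sigma> \<in> nbhd K U k\<close> that by (intro compare sub_I sub_W) auto
  qed
  show ?thesis
  proof (cases "\<sigma> \<in> nbhd K W k")
    case True
    then show ?thesis using K_U K_J W_I by blast
  next
    case False
    then have "(\<sigma>, \<tau>) \<notin> ?V (nbhd K W k)" "(\<sigma>, \<tau>) \<notin> ?V ?I"
      using alg_field_cells(1)[OF alg sub_W] alg_field_cells(1)[OF alg sub_I] by blast+
    then show ?thesis using K_U by blast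
  qed
qed

theorem corollary3p3:
  fixes K :: "'a cell_complex" and U W :: "'a set set"
    and \<alpha> :: "('a, 'd) algorithm" and D :: "'a set \<Rightarrow> 'd" and k :: nat
  assumes "regular_CW_complex K"
    and "subcomplex K U" and "subcomplex K W" and "cells K = U \<union> W"
    and "vector_field_algorithm \<alpha> K D"
    and "k \<ge> 1" and "uniformly_local \<alpha> K D k"
  shows "alg_field \<alpha> K D (cells K) =
    (alg_field \<alpha> K D (nbhd K U k) \<union> alg_field \<alpha> K D (nbhd K W k)) -
    (alg_field \<alpha> K D (nbhd K U k \<inter> nbhd K W k) -
     alg_field \<alpha> K D (nbhd K U (2 * k + 1) \<inter> nbhd K W (2 * k + 1)))"
    (is "?L = ?R")
proof -
  note part = regular_CW_complex_cell_partition[OF assms(1)]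
  have at_U: "(\<sigma>, \<tau>) \<in> ?L \<longleftrightarrow> (\<sigma>, \<tau>) \<in> ?R" if "\<sigma> \<in> U" for \<sigma> \<tau>
    by (rule alg_field_decomposition_at_cell[OF part assms(2,3,5-7) that])
  have at_W: "(\<sigma>, \<tau>) \<in> ?L \<longleftrightarrow> (\<sigma>, \<tau>) \<in> ?R" if "\<sigma> \<in> W" for \<sigma> \<tau>
    using alg_field_decomposition_at_cell[OF part assms(3,2,5-7) that]
    by (simp only: Un_commute Int_commute)
  have outside: "(\<sigma>, \<tau>) \<notin> ?L \<and> (\<sigma>, \<tau>) \<notin> ?R" if "\<sigma> \<notin> cells K" for \<sigma> \<tau>
  proof -
    have "(\<sigma>, \<tau>) \<notin> alg_field \<alpha> K D C" if "subcomplex K C" for C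
      using alg_field_cells(1)[OF assms(5) that] that \<open>\<sigma> \<notin> cells K\<close>
      unfolding subcomplex_def by blast
    then show ?thesis
      using subcomplex_cells[OF part] subcomplex_nbhd[OF part] assms(2,3) by blast
  qed
  have "(\<sigma>, \<tau>) \<in> ?L \<longleftrightarrow> (\<sigma>, \<tau>) \<in> ?R" for \<sigma> \<tau>
    using at_U[of \<sigma> \<tau>] at_W[of \<sigma> \<tau>] outside[of \<sigma> \<tau>] assms(4) by blast
  then show ?thesis by (intro set_eqI) (simp only: split_paired_all)
qed

end
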